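(* Let $N\ge 2$, $n\ge 1$, $V=\{1,\dots,N\}$, and let $a:[0,+\infty)\to[0,+\infty)$ be Lipschitz continuous, non-decreasing, with $a(r)>0$ for $r>0$. Let $\kappa=1$ and consider the topological bounded confidence model $$\dot x_i=\sum_{j\in N_i^t(x)}a(\|x_j-x_i\|)(x_j-x_i),\qquad i\in V,$$ with $x=(x_1,\dots,x_N)\in\mathbb{R}^{nN}$. Define $$I(r)=\int_0^r a(s)\,s\,ds,\qquad W(x)=\sum_{i\in V}\ \sum_{j\in N_i^t(x)} I(\|x_j-x_i\|).$$ Then, for every Caratheodory solution $x(\cdot)$ of the model, the function $t\mapsto W(x(t))$ is continuous and non-increasing.
   Context: For $\kappa=1$, $N_i^t(x)$ consists of the single index $j\in V\setminus\{i\}$ minimizing $\|x_j-x_i\|$ (Euclidean norm), where in case of ties the smallest such index is chosen. A Caratheodory solution of an ODE $\dot x=g(x)$ on $\mathbb{R}^m$ (here $m=nN$ and $g$ is possibly discontinuous) on $[0,T]$ is an absolutely continuous function $x:[0,T]\to\mathbb{R}^m$ with $\dot x(t)=g(x(t))$ for almost every $t\in[0,T]$. *)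

theory Defs
  imports "HOL-Analysis.Analysis"
begin

text \<open>Absolute continuity of a curve on \<open>{u..v}\<close>; HOL-Analysis only has the
  notion of the same name for measures.\<close>

definition absolutely_continuous_curve ::
    "real \<Rightarrow> real \<Rightarrow> (real \<Rightarrow> 'a::real_normed_vector) \<Rightarrow> bool" where
  "absolutely_continuous_curve u v x \<longleftrightarrow>
     (\<forall>\<epsilon>>0. \<exists>\<delta>>0. \<forall>(m::nat) (p::nat \<Rightarrow> real) (q::nat \<Rightarrow> real).
        (\<forall>k<m. u \<le> p k \<and> p k \<le> q k \<and> q k \<le> v) \<longrightarrow>
        disjoint_family_on (\<lambda>k. {p k<..<q k}) {..<m} \<longrightarrow>
        (\<Sum>k<m. q k - p k) < \<delta> \<longrightarrow>
        (\<Sum>k<m. norm (x (q k) - x (p k))) < \<epsilon>)"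

text \<open>Values of \<open>x\<close> outside \<open>{0..T}\<close> are irrelevant.\<close>

definition caratheodory_solution ::
    "('a::euclidean_space \<Rightarrow> 'a) \<Rightarrow> real \<Rightarrow> (real \<Rightarrow> 'a) \<Rightarrow> bool" where
  "caratheodory_solution g T x \<longleftrightarrow>
     absolutely_continuous_curve 0 T x \<and>
     (AE t in lebesgue. t \<in> {0..T} \<longrightarrow>
        (x has_vector_derivative g (x t)) (at t within {0..T}))"

text \<open>The agents \<open>1, \<dots>, N\<close> are the elements of a finite linearly ordered type \<open>'v\<close>
  with \<open>CARD('v) = N\<close>; the order serves only to break ties. A configuration
  \<open>x :: (real ^ 'n) ^ 'v\<close> has the state \<open>x $ i\<close> of agent \<open>i\<close> as its \<open>i\<close>-th block.\<close>

text \<open>For \<open>\<kappa> = 1\<close>. The \<open>Min\<close> is meaningful only if there are at least two agents.\<close>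

definition neighbours :: "(real ^ 'n) ^ 'v::{finite,linorder} \<Rightarrow> 'v \<Rightarrow> 'v set" where
  "neighbours x i =
     {Min {j. is_arg_min (\<lambda>k. norm (x $ k - x $ i)) (\<lambda>k. k \<in> UNIV - {i}) j}}"

definition topological_field ::
    "(real \<Rightarrow> real) \<Rightarrow> (real ^ 'n) ^ 'v::{finite,linorder} \<Rightarrow> (real ^ 'n) ^ 'v::{finite,linorder}" where
  "topological_field a x =
     (\<chi> i. \<Sum>j\<in>neighbours x i. a (norm (x $ j - x $ i)) *\<^sub>R (x $ j - x $ i))"

definition I_fun :: "(real \<Rightarrow> real) \<Rightarrow> real \<Rightarrow> real" where
  "I_fun a r = integral {0..r} (\<lambda>s. a s * s)"

definition W_fun :: "(real \<Rightarrow> real) \<Rightarrow> (real ^ 'n) ^ 'v::{finite,linorder} \<Rightarrow> real" where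
  "W_fun a x = (\<Sum>i\<in>UNIV. \<Sum>j\<in>neighbours x i. I_fun a (norm (x $ j - x $ i)))"

end

theory Submission
  imports Defs
begin

text \<open>Every agent \<open>i\<close> sees only its nearest agent \<open>j(i)\<close>, so \<open>W\<close> is the sum of \<open>I (d\<^sub>i)\<close>, where \<open>d\<^sub>i\<close>
  is the distance from \<open>i\<close> to \<open>j(i)\<close>. The neighbours jump along a solution, but a minimum of distances
  is Lipschitz in the state, which makes \<open>W\<close> locally Lipschitz in the state
  (\<open>W_fun_lipschitz\<close>). A solution is bounded, hence so is its velocity, hence the solution itself is
  Lipschitz in time (\<open>lipschitz_on_if_ae_bounded_derivative\<close>). Thus \<open>W\<close> is Lipschitz along solutions.

  For monotonicity, consider a time \<open>t\<close> at which the equation holds, with velocities \<open>v\<^sub>i\<close>, and keep the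
  neighbours \<open>j(i)\<close> of that time. At later times the true
  nearest distance is at most the distance to the old neighbour, so the increment of \<open>W\<close> is bounded
  by that of the sum with frozen neighbours, which is differentiable at \<open>t\<close>. As
  \<open>a (\<bar>z\<bar>) z\<close> is the gradient of \<open>I (\<bar>z\<bar>)\<close>, its derivative is \<open>\<Sum>\<^sub>i v\<^sub>i \<bullet> (v\<^bsub>j(i)\<^esub> - v\<^sub>i)\<close>.
  Every term is non-positive: the speed \<open>\<bar>v\<^sub>i\<bar> = a (d\<^sub>i) d\<^sub>i\<close> is non-decreasing in \<open>d\<^sub>i\<close>, and
  \<open>d\<^bsub>j(i)\<^esub> \<le> d\<^sub>i\<close> because \<open>i\<close> itself is a candidate neighbour of \<open>j(i)\<close>; now use Cauchy-Schwarz
  (\<open>topological_field_dissipative\<close>).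

  The comparison with the frozen neighbours works only forwards in time, so it controls
  the upper right Dini derivative of \<open>W\<close> (\<open>W_fun_right_dini\<close>). That is enough: a Lipschitz function whose
  upper right Dini derivative is non-positive almost everywhere is non-increasing
  (\<open>antimono_on_if_right_dini_nonpos\<close>).\<close>

section \<open>The potential of a distance\<close>

text \<open>Between \<open>r\<close> and \<open>r'\<close> the monotone factor \<open>a\<close> is compared with its value at the endpoint \<open>r'\<close>;
  the sign comes out right whether \<open>r'\<close> lies above or below \<open>r\<close>. Since squared norms are differentiable
  everywhere, this form of the bound avoids a case distinction for agents at the same position.\<close>

lemma I_fun_diff_le:
  fixes a :: "real \<Rightarrow> real"
  assumes cont: "continuous_on {0..} a" and mono: "mono_on {0..} a" and "0 \<le> r" "0 \<le> r'"
  shows "I_fun a r' - I_fun a r \<le> a r' * (r'\<^sup>2 - r\<^sup>2) / 2"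
proof -
  have int: "(\<lambda>s. a s * s) integrable_on {u..v}" if "0 \<le> u" for u v
    by (intro integrable_continuous_real continuous_intros continuous_on_subset[OF cont]) (use that in auto)
  have split: "I_fun a v - I_fun a u = integral {u..v} (\<lambda>s. a s * s)" if "0 \<le> u" "u \<le> v" for u v
    using Henstock_Kurzweil_Integration.integral_combine[OF that int[of 0 v]] by (simp add: I_fun_def)
  have lin: "((\<lambda>s. a c * s) has_integral a c * ((v\<^sup>2 - u\<^sup>2) / 2)) {u..v}" if "u \<le> v" for u v c
    using has_integral_mult_right[OF ident_has_integral[OF that], of "a c"] by (simp add: diff_divide_distrib)
  show ?thesis
  proof (cases "r \<le> r'")
    case True
    have "integral {r..r'} (\<lambda>s. a s * s) \<le> a r' * ((r'\<^sup>2 - r\<^sup>2) / 2)"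
    proof (rule has_integral_le[OF integrable_integral[OF int[OF \<open>0 \<le> r\<close>]] lin[OF True]])
      fix s assume "s \<in> {r..r'}"
      then show "a s * s \<le> a r' * s"
        using assms True by (intro mult_right_mono mono_onD[OF mono]) auto
    qed
    then show ?thesis
      using split[OF \<open>0 \<le> r\<close> True] by simp
  next
    case False
    then have le: "r' \<le> r" by simp
    have "a r' * ((r\<^sup>2 - r'\<^sup>2) / 2) \<le> integral {r'..r} (\<lambda>s. a s * s)"
    proof (rule has_integral_le[OF lin[OF le] integrable_integral[OF int[OF \<open>0 \<le> r'\<close>]]])
      fix s assume "s \<in> {r'..r}"
      then show "a r' * s \<le> a s * s"
        using assms by (intro mult_right_mono mono_onD[OF mono]) auto
    qed
    then show ?thesis
      using split[OF \<open>0 \<le> r'\<close> le] by (simp add: field_simps)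
  qed
qed

lemma I_fun_lipschitz:
  fixes a :: "real \<Rightarrow> real"
  assumes cont: "continuous_on {0..} a" and mono: "mono_on {0..} a"
    and nonneg: "\<And>r. 0 \<le> r \<Longrightarrow> 0 \<le> a r" and "0 \<le> R"
  shows "(a R * R)-lipschitz_on {0..R} (I_fun a)"
proof (rule lipschitz_onI)
  have le: "I_fun a r' - I_fun a r \<le> a R * R * \<bar>r' - r\<bar>" if "r \<in> {0..R}" "r' \<in> {0..R}" for r r'
  proof -
    have "r'\<^sup>2 - r\<^sup>2 = (r' + r) * (r' - r)" by (simp add: power2_eq_square algebra_simps)
    also have "\<dots> \<le> (r' + r) * \<bar>r' - r\<bar>"
      using that by (intro mult_left_mono) auto
    also have "\<dots> \<le> (R + R) * \<bar>r' - r\<bar>"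
      using that by (intro mult_right_mono add_mono) auto
    finally have *: "r'\<^sup>2 - r\<^sup>2 \<le> 2 * R * \<bar>r' - r\<bar>" by simp
    have "I_fun a r' - I_fun a r \<le> a r' * (r'\<^sup>2 - r\<^sup>2) / 2"
      using I_fun_diff_le[OF cont mono] that by auto
    also have "\<dots> \<le> a r' * (2 * R * \<bar>r' - r\<bar>) / 2"
      using * nonneg that by (intro divide_right_mono mult_left_mono) auto
    also have "\<dots> \<le> a R * (2 * R * \<bar>r' - r\<bar>) / 2"
      using that \<open>0 \<le> R\<close> by (intro divide_right_mono mult_right_mono mono_onD[OF mono]) auto
    finally show ?thesis by simp
  qed
  show "dist (I_fun a r) (I_fun a r') \<le> a R * R * dist r r'" if "r \<in> {0..R}" "r' \<in> {0..R}" for r r'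
    using le[OF that] le[OF that(2,1)] by (simp add: dist_real_def abs_minus_commute)
qed (use nonneg \<open>0 \<le> R\<close> in simp)

section \<open>Nearest neighbours\<close>

definition nearest :: "(real ^ 'n) ^ 'v::{finite,linorder} \<Rightarrow> 'v \<Rightarrow> 'v" where
  "nearest x i = the_elem (neighbours x i)"

lemma neighbours_eq: "neighbours x i = {nearest x i}"
  by (simp add: nearest_def neighbours_def)

lemma nearest:
  fixes x :: "(real ^ 'n) ^ 'v::{finite,linorder}"
  assumes "CARD('v) \<ge> 2"
  shows nearest_neq: "nearest x i \<noteq> i"
    and nearest_le: "k \<noteq> i \<Longrightarrow> norm (x $ nearest x i - x $ i) \<le> norm (x $ k - x $ i)"
proof -
  let ?A = "{j. is_arg_min (\<lambda>k. norm (x $ k - x $ i)) (\<lambda>k. k \<in> UNIV - {i}) j}"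
  have "UNIV - {i} \<noteq> {}"
  proof
    assume "UNIV - {i} = {}"
    then have "UNIV = {i}" by auto
    then have "CARD('v) = card {i}" by (rule arg_cong)
    with assms show False by simp
  qed
  then have "?A \<noteq> {}"
    using ex_is_arg_min_if_finite[of "UNIV - {i}" "\<lambda>k. norm (x $ k - x $ i)"] by auto
  then have "nearest x i \<in> ?A"
    using Min_in[of ?A] by (simp add: nearest_def neighbours_def)
  then show "nearest x i \<noteq> i" "k \<noteq> i \<Longrightarrow> norm (x $ nearest x i - x $ i) \<le> norm (x $ k - x $ i)"
    by (auto simp: is_arg_min_def not_less)
qed

lemma W_fun_eq: "W_fun a x = (\<Sum>i\<in>UNIV. I_fun a (norm (x $ nearest x i - x $ i)))"
  by (simp add: W_fun_def neighbours_eq)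

lemma topological_field_nth:
  "topological_field a x $ i = a (norm (x $ nearest x i - x $ i)) *\<^sub>R (x $ nearest x i - x $ i)"
  by (simp add: topological_field_def neighbours_eq)

text \<open>The nearest agent may differ between \<open>x\<close> and \<open>y\<close>. But the nearest agent of one configuration is a
  competitor in the other one, and moving both ends of a segment changes its length by
  at most twice the displacement of the configuration.\<close>

lemma nearest_distance_lipschitz:
  fixes x y :: "(real ^ 'n) ^ 'v::{finite,linorder}"
  assumes "CARD('v) \<ge> 2"
  shows "\<bar>norm (x $ nearest x i - x $ i) - norm (y $ nearest y i - y $ i)\<bar> \<le> 2 * norm (x - y)"
proof -
  have le: "norm (x $ nearest x i - x $ i) - norm (y $ nearest y i - y $ i) \<le> 2 * norm (x - y)"
    for x y :: "(real ^ 'n) ^ 'v::{finite,linorder}"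
  proof -
    define k where "k = nearest y i"
    have "norm (x $ nearest x i - x $ i) \<le> norm (x $ k - x $ i)"
      unfolding k_def by (intro nearest_le nearest_neq assms)
    also have "\<dots> = norm ((y $ k - y $ i) + ((x - y) $ k - (x - y) $ i))" by simp
    also have "\<dots> \<le> norm (y $ k - y $ i) + (norm ((x - y) $ k) + norm ((x - y) $ i))"
      by (intro norm_triangle_le add_left_mono norm_triangle_ineq4)
    also have "\<dots> \<le> norm (y $ k - y $ i) + (norm (x - y) + norm (x - y))"
      by (intro add_mono order_refl Finite_Cartesian_Product.norm_nth_le)
    finally show ?thesis by (simp add: k_def)
  qed
  show ?thesis using le[of x y] le[of y x] by (simp add: norm_minus_commute)
qed

lemma nearest_distance_le:
  fixes x :: "(real ^ 'n) ^ 'v::{finite,linorder}"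
  shows "norm (x $ nearest x i - x $ i) \<le> 2 * norm x"
  using norm_triangle_ineq4[of "x $ nearest x i" "x $ i"]
    Finite_Cartesian_Product.norm_nth_le[of x i] Finite_Cartesian_Product.norm_nth_le[of x "nearest x i"]
  by linarith

lemma norm_topological_field_le:
  fixes x :: "(real ^ 'n) ^ 'v::{finite,linorder}"
  assumes mono: "mono_on {0..} a" and nonneg: "\<And>r. 0 \<le> r \<Longrightarrow> 0 \<le> a r" and "norm x \<le> B"
  shows "norm (topological_field a x) \<le> real CARD('v) * (a (2 * B) * (2 * B))"
proof -
  have "norm (topological_field a x) \<le> (\<Sum>i\<in>UNIV. norm (topological_field a x $ i))"
    unfolding norm_vec_def by (rule L2_set_le_sum) simp
  also have "\<dots> \<le> (\<Sum>i\<in>(UNIV::'v set). a (2 * B) * (2 * B))"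
  proof (rule sum_mono)
    fix i :: 'v
    have d: "norm (x $ nearest x i - x $ i) \<le> 2 * B"
      using nearest_distance_le[of x i] assms(3) by linarith
    have "0 \<le> 2 * B" using norm_ge_zero[of x] assms(3) by linarith
    with d show "norm (topological_field a x $ i) \<le> a (2 * B) * (2 * B)"
      by (auto simp: topological_field_nth nonneg intro!: mult_mono mono_onD[OF mono])
  qed
  finally show ?thesis by simp
qed

text \<open>The agent \<open>i\<close> competes for being nearest to its own neighbour \<open>j\<close>, so \<open>j\<close> has a neighbour at most as
  far away as \<open>j\<close> is from \<open>i\<close>. As \<open>a\<close> is non-decreasing, \<open>j\<close> moves at most as fast as \<open>i\<close>.\<close>

lemma topological_field_dissipative:
  fixes x :: "(real ^ 'n) ^ 'v::{finite,linorder}"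
  assumes "CARD('v) \<ge> 2" and mono: "mono_on {0..} a" and nonneg: "\<And>r. 0 \<le> r \<Longrightarrow> 0 \<le> a r"
  defines "v \<equiv> topological_field a x"
  shows "v $ i \<bullet> (v $ nearest x i - v $ i) \<le> 0"
proof -
  define j where "j = nearest x i"
  have d: "norm (x $ nearest x j - x $ j) \<le> norm (x $ j - x $ i)"
    using nearest_le[OF assms(1), of i j x] nearest_neq[OF assms(1), of x i]
    by (simp add: j_def norm_minus_commute)
  have "norm (v $ j) \<le> norm (v $ i)"
    unfolding v_def topological_field_nth norm_scaleR j_def[symmetric]
    using d by (auto simp: nonneg intro!: mult_mono mono_onD[OF mono])
  then have "norm (v $ i) * norm (v $ j) \<le> norm (v $ i) * norm (v $ i)"
    by (intro mult_left_mono) auto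
  with norm_cauchy_schwarz[of "v $ i" "v $ j"] show ?thesis
    by (simp add: j_def inner_diff_right dot_square_norm power2_eq_square)
qed

lemma W_fun_lipschitz:
  fixes a :: "real \<Rightarrow> real"
  assumes card: "CARD('v::{finite,linorder}) \<ge> 2" and nonneg: "\<And>r. 0 \<le> r \<Longrightarrow> 0 \<le> a r"
    and cont: "continuous_on {0..} a" and mono: "mono_on {0..} a" and "0 \<le> B"
  shows "\<exists>C. C-lipschitz_on (cball 0 B) (W_fun a :: (real ^ 'n) ^ 'v::{finite,linorder} \<Rightarrow> real)"
proof -
  let ?L = "a (2 * B) * (2 * B)"
  have L: "?L-lipschitz_on {0..2 * B} (I_fun a)"
    using I_fun_lipschitz[OF cont mono nonneg, of "2 * B"] \<open>0 \<le> B\<close> by simp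
  have "(real CARD('v) * (?L * 2))-lipschitz_on (cball 0 B) (W_fun a :: (real ^ 'n) ^ 'v::{finite,linorder} \<Rightarrow> real)"
  proof (rule lipschitz_onI)
    fix x y :: "(real ^ 'n) ^ 'v::{finite,linorder}" assume xy: "x \<in> cball 0 B" "y \<in> cball 0 B"
    let ?d = "\<lambda>(x :: (real ^ 'n) ^ 'v::{finite,linorder}) i. norm (x $ nearest x i - x $ i)"
    have mem: "?d x i \<in> {0..2 * B}" if "x \<in> cball 0 B" for x i
      using nearest_distance_le[of x i] that by auto
    have "dist (I_fun a (?d x i)) (I_fun a (?d y i)) \<le> ?L * 2 * dist x y" for i
    proof -
      have "dist (I_fun a (?d x i)) (I_fun a (?d y i)) \<le> ?L * dist (?d x i) (?d y i)"
        using mem xy by (intro lipschitz_onD[OF L])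
      also have "\<dots> \<le> ?L * (2 * norm (x - y))"
        using nearest_distance_lipschitz[OF card, of x i y] lipschitz_on_nonneg[OF L]
        by (intro mult_left_mono) (auto simp: dist_real_def)
      finally show ?thesis by (simp add: dist_norm)
    qed
    then have "(\<Sum>i\<in>UNIV. dist (I_fun a (?d x i)) (I_fun a (?d y i))) \<le> (\<Sum>i\<in>(UNIV::'v set). ?L * 2 * dist x y)"
      by (rule sum_mono)
    moreover have "dist (W_fun a x) (W_fun a y) \<le> (\<Sum>i\<in>UNIV. dist (I_fun a (?d x i)) (I_fun a (?d y i)))"
      by (simp add: W_fun_eq dist_real_def sum_subtractf[symmetric] sum_abs)
    ultimately show "dist (W_fun a x) (W_fun a y) \<le> real CARD('v) * (?L * 2) * dist x y" by simp
  qed (use nonneg[of "2 * B"] \<open>0 \<le> B\<close> in simp)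
  then show ?thesis ..
qed

section \<open>Monotonicity from right Dini derivatives\<close>

lemma le_if_locally_right_le:
  fixes h :: "real \<Rightarrow> real"
  assumes "u \<le> v" and cont: "continuous_on {u..v} h"
    and right: "\<And>t. t \<in> {u..<v} \<Longrightarrow> \<forall>\<^sub>F s in at_right t. h s \<le> h t"
  shows "h v \<le> h u"
proof -
  \<comment> \<open>The largest point where the claim holds cannot lie to the left of \<open>v\<close>.\<close>
  define S where "S = {t \<in> {u..v}. h t \<le> h u}"
  have "closed S"
    unfolding S_def by (rule continuous_on_closed_Collect_le) (use cont in auto)
  have bdd: "bdd_above S" and ne: "S \<noteq> {}"
    using \<open>u \<le> v\<close> by (auto simp: S_def intro!: bdd_aboveI[of _ v])
  have c: "Sup S \<in> S" using closed_contains_Sup[OF ne bdd \<open>closed S\<close>] .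
  have "Sup S = v"
  proof (rule ccontr)
    assume "Sup S \<noteq> v"
    with c have lt: "Sup S \<in> {u..<v}" by (auto simp: S_def)
    then have "\<forall>\<^sub>F s in at_right (Sup S). h s \<le> h (Sup S) \<and> s \<in> {Sup S<..<v}"
      by (intro eventually_conj right eventually_at_right_real) auto
    then obtain s where "h s \<le> h (Sup S)" "s \<in> {Sup S<..<v}"
      using eventually_happens'[OF trivial_limit_at_right_real] by blast
    then have "s \<in> S" using c by (auto simp: S_def)
    with cSup_upper[OF _ bdd] \<open>s \<in> {Sup S<..<v}\<close> show False by force
  qed
  with c show ?thesis by (simp add: S_def)
qed

lemma negligible_outer_open:
  fixes E :: "'a::euclidean_space set"
  assumes "negligible E" "0 < \<delta>"
  obtains U where "open U" "E \<subseteq> U" "U \<in> lmeasurable" "measure lebesgue U < \<delta>"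
proof -
  have E: "E \<in> null_sets lebesgue" "E \<in> lmeasurable"
    using assms(1) by (auto simp: negligible_iff_null_sets[symmetric] negligible_imp_measurable)
  obtain U where U: "open U" "E \<subseteq> U" "U - E \<in> lmeasurable" "emeasure lebesgue (U - E) < ennreal \<delta>"
    using sets_lebesgue_outer_open[OF fmeasurableD[OF E(2)] assms(2)] .
  have "U = (U - E) \<union> E" using U(2) by auto
  then have "U \<in> lmeasurable" using fmeasurable.Un[OF U(3) E(2)] by simp
  moreover have "measure lebesgue U < \<delta>"
    using U(4) measure_Diff_null_set[OF fmeasurableD[OF \<open>U \<in> lmeasurable\<close>] E(1)] assms(2)
    by (simp add: emeasure_eq_measure2[OF U(3)] ennreal_less_iff)
  ultimately show ?thesis using that U by blast
qed

text \<open>Take an open set \<open>U\<close> of measure less than \<open>\<epsilon>\<close> around \<open>E\<close>. The function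
  \<open>f r - \<epsilon> (r - s) - M |U \<inter> [s, r]|\<close> does not increase to the right of any point: outside \<open>E\<close> by the
  assumption on \<open>f\<close>, and in \<open>E\<close> because the last term there has slope \<open>-M\<close>. The two corrections
  vanish with \<open>\<epsilon>\<close>.\<close>

lemma antimono_on_if_right_dini_nonpos:
  fixes f :: "real \<Rightarrow> real"
  assumes lip: "M-lipschitz_on {u..v} f" and E: "negligible E"
    and dini: "\<And>t \<epsilon>. t \<in> {u..<v} - E \<Longrightarrow> 0 < \<epsilon> \<Longrightarrow> \<forall>\<^sub>F s in at_right t. f s - f t \<le> \<epsilon> * (s - t)"
  shows "antimono_on {u..v} f"
proof (rule monotone_onI)
  fix s t assume st: "s \<in> {u..v}" "t \<in> {u..v}" "s \<le> t"
  have M: "0 \<le> M" using lip by (rule lipschitz_on_nonneg)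
  have approx: "f t \<le> f s + \<epsilon> * (t - s + M)" if "0 < \<epsilon>" for \<epsilon>
  proof -
    obtain U where U: "open U" "E \<subseteq> U" "U \<in> lmeasurable" "measure lebesgue U < \<epsilon>"
      using negligible_outer_open[OF E \<open>0 < \<epsilon>\<close>] .
    define \<mu> where "\<mu> r = measure lebesgue (U \<inter> {s..r})" for r
    have \<mu>_diff: "\<mu> r' = \<mu> r + measure lebesgue (U \<inter> {r<..r'})" if "s \<le> r" "r \<le> r'" for r r'
    proof -
      have "U \<inter> {s..r'} = (U \<inter> {s..r}) \<union> (U \<inter> {r<..r'})" using that by auto
      moreover have "(U \<inter> {s..r}) \<inter> (U \<inter> {r<..r'}) = {}" by auto
      ultimately show ?thesis
        using measure_Un3[of "U \<inter> {s..r}" lebesgue "U \<inter> {r<..r'}"] U(3)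
        by (simp add: \<mu>_def fmeasurable_Int_fmeasurable)
    qed
    have \<mu>_le: "measure lebesgue (U \<inter> {r<..r'}) \<le> r' - r" if "r \<le> r'" for r r'
    proof -
      have "measure lebesgue (U \<inter> {r<..r'}) \<le> measure lebesgue {r..r'}"
        using fmeasurableD[OF U(3)] by (intro measure_mono_fmeasurable) auto
      then show ?thesis using that by simp
    qed
    have "1-lipschitz_on {s..t} \<mu>"
    proof (rule lipschitz_onI)
      fix r r' assume "r \<in> {s..t}" "r' \<in> {s..t}"
      then show "dist (\<mu> r) (\<mu> r') \<le> 1 * dist r r'"
        using \<mu>_diff[of r r'] \<mu>_le[of r r'] \<mu>_diff[of r' r] \<mu>_le[of r' r]
        by (cases "r \<le> r'") (auto simp: dist_real_def)
    qed simp
    then have "continuous_on {s..t} \<mu>" by (rule lipschitz_on_continuous_on)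
    moreover have "continuous_on {s..t} f"
      using lipschitz_on_continuous_on[OF lip] st by (auto intro: continuous_on_subset)
    ultimately have cont: "continuous_on {s..t} (\<lambda>r. f r - \<epsilon> * (r - s) - M * \<mu> r)"
      by (intro continuous_intros)
    have "f t - \<epsilon> * (t - s) - M * \<mu> t \<le> f s - \<epsilon> * (s - s) - M * \<mu> s"
    proof (rule le_if_locally_right_le[OF st(3) cont])
      fix r assume r: "r \<in> {s..<t}"
      then have ruv: "r \<in> {u..<v}" using st by auto
      have right: "\<forall>\<^sub>F r' in at_right r. r' \<in> {r<..<t}"
        using r by (intro eventually_at_right_real) auto
      show "\<forall>\<^sub>F r' in at_right r. f r' - \<epsilon> * (r' - s) - M * \<mu> r' \<le> f r - \<epsilon> * (r - s) - M * \<mu> r"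
      proof (cases "r \<in> E")
        case False
        then have "\<forall>\<^sub>F r' in at_right r. f r' - f r \<le> \<epsilon> * (r' - r)"
          using ruv \<open>0 < \<epsilon>\<close> by (intro dini) auto
        with right show ?thesis
        proof eventually_elim
          case (elim r')
          have "\<mu> r \<le> \<mu> r'" using \<mu>_diff[of r r'] elim r by simp
          then have "M * \<mu> r \<le> M * \<mu> r'" using M by (rule mult_left_mono)
          with elim show ?case by (simp add: algebra_simps)
        qed
      next
        case True
        then obtain e where e: "0 < e" "ball r e \<subseteq> U" using U openE by blast
        then have "\<forall>\<^sub>F r' in at_right r. r' \<in> {r<..<r + e}"
          by (intro eventually_at_right_real) auto
        with right show ?thesis
        proof eventually_elim
          case (elim r')
          then have "U \<inter> {r<..r'} = {r<..r'}" using e(2) by (force simp: ball_def dist_real_def)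
          then have "\<mu> r' = \<mu> r + (r' - r)" using \<mu>_diff[of r r'] elim r by simp
          then have "M * \<mu> r' = M * \<mu> r + M * (r' - r)" by (simp add: distrib_left)
          moreover have "f r' - f r \<le> M * (r' - r)"
            using lipschitz_onD[OF lip, of r' r] elim r st by (auto simp: dist_real_def)
          moreover have "\<epsilon> * (r - s) \<le> \<epsilon> * (r' - s)" using elim \<open>0 < \<epsilon>\<close> by auto
          ultimately show ?case by (simp add: algebra_simps)
        qed
      qed
    qed
    moreover have "M * \<mu> t \<le> M * \<epsilon>"
    proof (rule mult_left_mono[OF _ M])
      have "\<mu> t \<le> measure lebesgue U"
        unfolding \<mu>_def using U(3) by (intro measure_mono_fmeasurable) auto
      with U(4) show "\<mu> t \<le> \<epsilon>" by simp
    qed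
    moreover have "0 \<le> M * \<mu> s" using M by (simp add: \<mu>_def)
    ultimately show ?thesis by (simp add: algebra_simps)
  qed
  show "f t \<le> f s"
  proof (rule field_le_epsilon)
    fix e :: real assume "0 < e"
    moreover have pos: "0 < t - s + M + 1" using st M by simp
    ultimately have "f t \<le> f s + e / (t - s + M + 1) * (t - s + M)" by (intro approx) auto
    also have "\<dots> \<le> f s + e" using \<open>0 < e\<close> pos by (simp add: field_simps)
    finally show "f t \<le> f s + e" .
  qed
qed

section \<open>Absolutely continuous curves\<close>

lemma absolutely_continuous_curve_imp_continuous_on:
  assumes "absolutely_continuous_curve u v x"
  shows "continuous_on {u..v} x"
  unfolding continuous_on_iff
proof (intro ballI allI impI)
  fix t and \<epsilon> :: real assume t: "t \<in> {u..v}" and "0 < \<epsilon>"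
  then obtain \<delta> where "0 < \<delta>" and \<delta>: "\<And>(m::nat) p q. (\<forall>k<m. u \<le> p k \<and> p k \<le> q k \<and> q k \<le> v) \<Longrightarrow>
        disjoint_family_on (\<lambda>k. {p k<..<q k}) {..<m} \<Longrightarrow> (\<Sum>k<m. q k - p k) < \<delta> \<Longrightarrow>
        (\<Sum>k<m. norm (x (q k) - x (p k))) < \<epsilon>"
    using assms unfolding absolutely_continuous_curve_def by meson
  have "dist (x s) (x t) < \<epsilon>" if "s \<in> {u..v}" "dist s t < \<delta>" for s
    using \<delta>[of 1 "\<lambda>_. min s t" "\<lambda>_. max s t"] that t
    by (cases "s \<le> t") (auto simp: dist_norm disjoint_family_on_def norm_minus_commute min_def max_def)
  with \<open>0 < \<delta>\<close> show "\<exists>\<delta>>0. \<forall>s\<in>{u..v}. dist s t < \<delta> \<longrightarrow> dist (x s) (x t) < \<epsilon>" by blast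
qed

text \<open>Cousin's lemma yields a tagged division that is fine for the following gauge. Around a tag outside
  \<open>E\<close> the increment of \<open>x\<close> over a cell is at most \<open>M + \<epsilon>\<close> times its length. The cells with a tag in \<open>E\<close> lie
  in an open set of small measure around \<open>E\<close>, so absolute continuity makes their total increment small.\<close>

lemma lipschitz_on_if_ae_bounded_derivative:
  fixes x :: "real \<Rightarrow> 'a::real_normed_vector"
  assumes ac: "absolutely_continuous_curve u v x" and E: "negligible E" and "0 \<le> M"
    and deriv: "\<And>t. t \<in> {u..v} - E \<Longrightarrow>
      \<exists>D. norm D \<le> M \<and> (x has_vector_derivative D) (at t within {u..v})"
  shows "M-lipschitz_on {u..v} x"
proof -
  have approx: "norm (x t - x s) \<le> (M + \<epsilon>) * (t - s) + \<epsilon>"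
    if st: "u \<le> s" "s \<le> t" "t \<le> v" and "0 < \<epsilon>" for s t \<epsilon>
  proof -
    obtain \<delta> where "0 < \<delta>" and \<delta>: "\<And>(m::nat) p q. (\<And>k. k < m \<Longrightarrow> u \<le> p k \<and> p k \<le> q k \<and> q k \<le> v) \<Longrightarrow>
        disjoint_family_on (\<lambda>k. {p k<..<q k}) {..<m} \<Longrightarrow> (\<Sum>k<m. q k - p k) < \<delta> \<Longrightarrow>
        (\<Sum>k<m. norm (x (q k) - x (p k))) < \<epsilon>"
      using ac \<open>0 < \<epsilon>\<close> unfolding absolutely_continuous_curve_def by meson
    obtain U where U: "open U" "E \<subseteq> U" "U \<in> lmeasurable" "measure lebesgue U < \<delta>"
      using negligible_outer_open[OF E \<open>0 < \<delta>\<close>] .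
    have "\<exists>d>0. \<forall>y\<in>{u..v}. \<bar>y - z\<bar> < d \<longrightarrow> norm (x y - x z) \<le> (M + \<epsilon>) * \<bar>y - z\<bar>"
      if z: "z \<in> {u..v} - E" for z
    proof -
      obtain D where D: "norm D \<le> M" "(x has_vector_derivative D) (at z within {u..v})"
        using deriv[OF z] by blast
      obtain d where "0 < d" and d: "\<And>y. y \<in> {u..v} \<Longrightarrow> \<bar>y - z\<bar> < d \<Longrightarrow>
          norm (x y - x z - (y - z) *\<^sub>R D) \<le> \<epsilon> * \<bar>y - z\<bar>"
        using D(2) \<open>0 < \<epsilon>\<close> unfolding has_vector_derivative_def has_derivative_within_alt
        by (auto simp: real_norm_def)
      have "norm (x y - x z) \<le> (M + \<epsilon>) * \<bar>y - z\<bar>" if y: "y \<in> {u..v}" "\<bar>y - z\<bar> < d" for y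
      proof -
        have "norm (x y - x z) \<le> norm (x y - x z - (y - z) *\<^sub>R D) + norm ((y - z) *\<^sub>R D)"
          using norm_triangle_ineq[of "x y - x z - (y - z) *\<^sub>R D" "(y - z) *\<^sub>R D"] by simp
        also have "\<dots> \<le> \<epsilon> * \<bar>y - z\<bar> + \<bar>y - z\<bar> * M"
          using d[OF y] D(1) by (intro add_mono) (auto intro: mult_left_mono)
        finally show ?thesis by (simp add: algebra_simps)
      qed
      with \<open>0 < d\<close> show ?thesis by blast
    qed
    then obtain d where d: "\<And>z. z \<in> {u..v} - E \<Longrightarrow> 0 < d z"
      "\<And>z y. z \<in> {u..v} - E \<Longrightarrow> y \<in> {u..v} \<Longrightarrow> \<bar>y - z\<bar> < d z \<Longrightarrow>
        norm (x y - x z) \<le> (M + \<epsilon>) * \<bar>y - z\<bar>"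
      by metis
    \<comment> \<open>The choice outside \<open>{u..v}\<close> is arbitrary, because all tags lie in \<open>{s..t}\<close>.\<close>
    define \<gamma> where "\<gamma> z = (if z \<in> E then U else if z \<in> {u..v} then ball z (d z) else UNIV)" for z
    have "gauge \<gamma>"
      using U d(1) by (auto simp: gauge_def \<gamma>_def)
    then obtain p where p: "p tagged_division_of {s..t}" "\<gamma> fine p"
      by (rule fine_division_exists_real)
    have fin: "finite p" using p(1) by auto
    have K: "K = {Inf K..Sup K}" "Inf K \<le> z" "z \<le> Sup K" "s \<le> Inf K" "Sup K \<le> t"
      "interior K = {Inf K<..<Sup K}" "K \<subseteq> \<gamma> z" if zK: "(z, K) \<in> p" for z K
    proof -
      obtain \<alpha> \<beta> where ab: "K = {\<alpha>..\<beta>}" using tagged_division_ofD(4)[OF p(1) zK] by auto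
      have z: "z \<in> K" "K \<subseteq> {s..t}" using tagged_division_ofD(2,3)[OF p(1) zK] by auto
      show "K = {Inf K..Sup K}" "Inf K \<le> z" "z \<le> Sup K" "s \<le> Inf K" "Sup K \<le> t"
        "interior K = {Inf K<..<Sup K}" using z ab by auto
      show "K \<subseteq> \<gamma> z" using p(2) zK by (auto simp: fine_def)
    qed
    define Q where "Q = {(z, K) \<in> p. z \<in> E}"
    have Q: "Q \<subseteq> p" "finite Q" using fin by (auto simp: Q_def intro: finite_subset)
    define var where "var = (\<lambda>(z::real, K::real set). norm (x (Sup K) - x (Inf K)))"
    have good: "var zK \<le> (M + \<epsilon>) * measure lborel (snd zK)" if "zK \<in> p - Q" for zK
    proof -
      obtain z K where zK: "zK = (z, K)" by fastforce
      with that have "(z, K) \<in> p" "z \<notin> E" by (auto simp: Q_def)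
      note K = K[OF this(1)]
      have z: "z \<in> {u..v} - E" using K st \<open>z \<notin> E\<close> by auto
      then have "K \<subseteq> ball z (d z)" using K(7) by (auto simp: \<gamma>_def)
      moreover have "Inf K \<in> K" "Sup K \<in> K" using K(1,2,3) by (metis atLeastAtMost_iff order_refl order_trans)+
      ultimately have near: "\<bar>Inf K - z\<bar> < d z" "\<bar>Sup K - z\<bar> < d z"
        by (auto simp: dist_real_def subset_eq abs_minus_commute)
      have "norm (x (Sup K) - x (Inf K)) \<le> norm (x (Sup K) - x z) + norm (x (Inf K) - x z)"
        using norm_triangle_ineq4[of "x (Sup K) - x z" "x (Inf K) - x z"] by simp
      also have "\<dots> \<le> (M + \<epsilon>) * \<bar>Sup K - z\<bar> + (M + \<epsilon>) * \<bar>Inf K - z\<bar>"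
        using K st by (intro add_mono d(2)[OF z] near) auto
      also have "\<dots> = (M + \<epsilon>) * (Sup K - Inf K)" using K by (simp add: algebra_simps)
      also have "Sup K - Inf K = measure lborel K"
        using K(2,3) by (subst K(1)) simp
      finally show ?thesis by (simp add: zK var_def)
    qed
    have "sum var (p - Q) \<le> (M + \<epsilon>) * (\<Sum>zK\<in>p - Q. measure lborel (snd zK))"
      unfolding sum_distrib_left by (rule sum_mono) (rule good)
    also have "\<dots> \<le> (M + \<epsilon>) * (\<Sum>zK\<in>p. measure lborel (snd zK))"
      using \<open>0 \<le> M\<close> \<open>0 < \<epsilon>\<close> fin by (intro mult_left_mono sum_mono2) auto
    also have "(\<Sum>zK\<in>p. measure lborel (snd zK)) = t - s"
      using additive_content_tagged_division[of p s t] p(1) st by (simp add: case_prod_beta)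
    finally have good_sum: "sum var (p - Q) \<le> (M + \<epsilon>) * (t - s)" .

    \<comment> \<open>The definition of absolute continuity asks for an enumerated family of intervals.\<close>
    obtain h where h: "bij_betw h {..<card Q} Q"
      using ex_bij_betw_nat_finite[OF Q(2)] by (auto simp: atLeast0LessThan)
    have hQ: "(fst (h k), snd (h k)) \<in> Q" if "k < card Q" for k
      using h that by (auto simp: bij_betw_def)
    define lo hi where "lo k = Inf (snd (h k))" and "hi k = Sup (snd (h k))" for k
    have disj: "disjoint_family_on (\<lambda>k. {lo k<..<hi k}) {..<card Q}"
    proof (unfold disjoint_family_on_def, intro ballI impI)
      fix k l assume kl: "k \<in> {..<card Q}" "l \<in> {..<card Q}" "k \<noteq> l"
      then have "h k \<noteq> h l" using h by (auto simp: bij_betw_def inj_on_def)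
      then have "interior (snd (h k)) \<inter> interior (snd (h l)) = {}"
        using tagged_division_ofD(5)[OF p(1), of "fst (h k)" "snd (h k)" "fst (h l)" "snd (h l)"]
          hQ kl Q(1) by (auto simp: prod_eq_iff)
      moreover have "(fst (h k), snd (h k)) \<in> p" "(fst (h l), snd (h l)) \<in> p"
        using hQ kl Q(1) by blast+
      ultimately show "{lo k<..<hi k} \<inter> {lo l<..<hi l} = {}"
        unfolding lo_def hi_def by (simp only: K(6))
    qed
    have le: "lo k \<le> hi k" "u \<le> lo k" "hi k \<le> v" "{lo k<..<hi k} \<subseteq> U" if "k < card Q" for k
    proof -
      have "(fst (h k), snd (h k)) \<in> p" "fst (h k) \<in> E" using hQ[OF that] by (auto simp: Q_def)
      note K = K[OF this(1)] and this(2)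
      show "lo k \<le> hi k" "u \<le> lo k" "hi k \<le> v" using K st by (auto simp: lo_def hi_def)
      have "interior (snd (h k)) \<subseteq> U"
        using K(7) \<open>fst (h k) \<in> E\<close> interior_subset by (fastforce simp: \<gamma>_def)
      then show "{lo k<..<hi k} \<subseteq> U" using K(6) by (simp add: lo_def hi_def)
    qed
    have "(\<Sum>k<card Q. hi k - lo k) = (\<Sum>k<card Q. measure lebesgue {lo k<..<hi k})"
      using le by (intro sum.cong) auto
    also have "\<dots> = measure lebesgue (\<Union>k<card Q. {lo k<..<hi k})"
      by (rule measure_finite_Union[symmetric]) (use disj le in auto)
    also have "\<dots> \<le> measure lebesgue U"
      using le(4) U(3) by (intro measure_mono_fmeasurable) auto
    finally have "(\<Sum>k<card Q. hi k - lo k) < \<delta>" using U(4) by simp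
    then have "(\<Sum>k<card Q. norm (x (hi k) - x (lo k))) < \<epsilon>"
      using le disj by (intro \<delta>) auto
    moreover have "(\<Sum>k<card Q. norm (x (hi k) - x (lo k))) = sum var Q"
      by (subst sum.reindex_bij_betw[OF h, symmetric])
        (simp add: var_def lo_def hi_def case_prod_beta)
    ultimately have bad_sum: "sum var Q < \<epsilon>" by simp

    have "norm (x t - x s) = norm (\<Sum>(z, K)\<in>p. x (Sup K) - x (Inf K))"
      using additive_tagged_division_1[OF st(2) p(1), of x] by simp
    also have "\<dots> \<le> sum var p"
      by (rule order_trans[OF norm_sum]) (simp add: var_def case_prod_beta)
    also have "\<dots> = sum var (p - Q) + sum var Q"
      by (rule sum.subset_diff[OF Q(1) fin])
    finally show ?thesis using good_sum bad_sum by simp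
  qed
  have main: "norm (x t - x s) \<le> M * (t - s)" if st: "u \<le> s" "s \<le> t" "t \<le> v" for s t
  proof (rule field_le_epsilon)
    fix e :: real assume "0 < e"
    have pos: "0 < t - s + 1" using st by simp
    \<comment> \<open>This \<open>\<epsilon>\<close> solves \<open>\<epsilon> (t - s) + \<epsilon> = e\<close>.\<close>
    define \<epsilon> where "\<epsilon> = e / (t - s + 1)"
    have "\<epsilon> * (t - s + 1) = e" using pos by (simp add: \<epsilon>_def)
    then have eq: "(M + \<epsilon>) * (t - s) + \<epsilon> = M * (t - s) + e" by (simp add: algebra_simps)
    have "0 < \<epsilon>" using \<open>0 < e\<close> pos by (simp add: \<epsilon>_def)
    from approx[OF st this] show "norm (x t - x s) \<le> M * (t - s) + e" by (simp only: eq)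
  qed
  show ?thesis
  proof (rule lipschitz_onI)
    fix s t assume "s \<in> {u..v}" "t \<in> {u..v}"
    then show "dist (x s) (x t) \<le> M * dist s t"
      using main[of s t] main[of t s]
      by (cases "s \<le> t") (auto simp: dist_norm norm_minus_commute)
  qed fact
qed

section \<open>The potential along solutions\<close>

text \<open>At times \<open>s > t\<close> the function \<open>q i\<close> below bounds the difference quotient of the \<open>i\<close>-th term of \<open>W\<close>
  from above, and it converges although the nearest neighbours may change immediately after \<open>t\<close>.\<close>

lemma W_fun_right_dini:
  fixes x :: "real \<Rightarrow> (real ^ 'n) ^ 'v::{finite,linorder}"
  assumes card: "CARD('v) \<ge> 2" and nonneg: "\<And>r. 0 \<le> r \<Longrightarrow> 0 \<le> a r"
    and cont: "continuous_on {0..} a" and mono: "mono_on {0..} a"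
    and deriv: "(x has_vector_derivative topological_field a (x t)) (at t within S)" and "0 < \<epsilon>"
  shows "\<forall>\<^sub>F s in at t within S \<inter> {t<..}. W_fun a (x s) - W_fun a (x t) \<le> \<epsilon> * (s - t)"
proof -
  define J where "J = nearest (x t)"
  define v where "v = topological_field a (x t)"
  define z where "z i s = x s $ J i - x s $ i" for i s
  define q where "q i s = a (norm (z i s)) * ((z i s \<bullet> z i s - z i t \<bullet> z i t) / (s - t)) / 2" for i s
  have bound: "W_fun a (x s) - W_fun a (x t) \<le> (\<Sum>i\<in>UNIV. q i s) * (s - t)" if "s \<noteq> t" for s
  proof -
    have cancel: "A * (X / d) / 2 * d = A * X / 2" if "d \<noteq> 0" for A X d :: real
      using that by simp
    have "I_fun a (norm (x s $ nearest (x s) i - x s $ i)) - I_fun a (norm (z i t)) \<le> q i s * (s - t)" for i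
    proof -
      \<comment> \<open>At time \<open>s\<close> the old neighbour \<open>J i\<close> is still a candidate.\<close>
      let ?r = "norm (x s $ nearest (x s) i - x s $ i)"
      have "?r \<le> norm (z i s)"
        unfolding z_def J_def by (intro nearest_le nearest_neq card)
      then have "I_fun a ?r \<le> I_fun a (norm (z i s))"
        using I_fun_diff_le[OF cont mono, of "norm (z i s)" ?r] nonneg[of ?r]
          power_mono[of ?r "norm (z i s)" 2] mult_nonneg_nonpos[of "a ?r" "?r\<^sup>2 - (norm (z i s))\<^sup>2"]
        by simp
      moreover have "I_fun a (norm (z i s)) - I_fun a (norm (z i t)) \<le> q i s * (s - t)"
        using I_fun_diff_le[OF cont mono, of "norm (z i t)" "norm (z i s)"] that
        unfolding q_def by (subst cancel) (auto simp: power2_norm_eq_inner)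
      ultimately show ?thesis by simp
    qed
    from sum_mono[of UNIV, OF this] show ?thesis
      by (simp add: W_fun_eq sum_subtractf sum_distrib_right z_def J_def)
  qed
  have "(q i \<longlongrightarrow> v $ i \<bullet> (v $ J i - v $ i)) (at t within S)" for i
  proof -
    have "((\<lambda>s. x s $ k) has_vector_derivative v $ k) (at t within S)" for k
      using bounded_linear.has_vector_derivative[OF bounded_linear_vec_nth deriv] by (simp add: v_def)
    then have z': "(z i has_vector_derivative v $ J i - v $ i) (at t within S)"
      unfolding z_def by (intro has_vector_derivative_diff)
    have "((\<lambda>s. z i s \<bullet> z i s) has_real_derivative 2 * (z i t \<bullet> (v $ J i - v $ i))) (at t within S)"
      using bounded_bilinear.has_vector_derivative[OF bounded_bilinear_inner z' z']
      by (simp add: has_real_derivative_iff_has_vector_derivative inner_commute)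
    then have quot: "((\<lambda>s. (z i s \<bullet> z i s - z i t \<bullet> z i t) / (s - t)) \<longlongrightarrow> 2 * (z i t \<bullet> (v $ J i - v $ i))) (at t within S)"
      by (simp add: has_field_derivative_iff)
    have "(z i \<longlongrightarrow> z i t) (at t within S)"
      using has_vector_derivative_continuous[OF z'] by (simp add: continuous_within)
    then have "((\<lambda>s. a (norm (z i s))) \<longlongrightarrow> a (norm (z i t))) (at t within S)"
      by (intro continuous_on_tendsto_compose[OF cont] tendsto_norm) auto
    from tendsto_divide[OF tendsto_mult[OF this quot] tendsto_const[of 2]]
    show ?thesis
      by (simp add: q_def[abs_def] v_def topological_field_nth z_def J_def)
  qed
  then have "((\<lambda>s. \<Sum>i\<in>UNIV. q i s) \<longlongrightarrow> (\<Sum>i\<in>UNIV. v $ i \<bullet> (v $ J i - v $ i))) (at t within S)"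
    by (rule tendsto_sum)
  moreover have "(\<Sum>i\<in>UNIV. v $ i \<bullet> (v $ J i - v $ i)) < \<epsilon>"
  proof -
    have "(\<Sum>i\<in>UNIV. v $ i \<bullet> (v $ J i - v $ i)) \<le> 0"
      unfolding v_def J_def by (intro sum_nonpos topological_field_dissipative card mono nonneg)
    with \<open>0 < \<epsilon>\<close> show ?thesis by simp
  qed
  ultimately have "\<forall>\<^sub>F s in at t within S. (\<Sum>i\<in>UNIV. q i s) < \<epsilon>"
    by (rule order_tendstoD)
  then have "\<forall>\<^sub>F s in at t within S \<inter> {t<..}. (\<Sum>i\<in>UNIV. q i s) < \<epsilon>"
    by (rule filter_leD[OF at_le, rotated]) simp
  moreover have "\<forall>\<^sub>F s in at t within S \<inter> {t<..}. t < s"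
    by (auto simp: eventually_at_filter)
  ultimately show ?thesis
  proof eventually_elim
    case (elim s)
    then have "(\<Sum>i\<in>UNIV. q i s) * (s - t) \<le> \<epsilon> * (s - t)" by (intro mult_right_mono) auto
    with elim show ?case using order_trans[OF bound[of s]] by simp
  qed
qed

theorem proposition13:
  fixes a :: "real \<Rightarrow> real"
    and x :: "real \<Rightarrow> (real ^ 'n) ^ 'v::{finite,linorder}"
    and T :: real
  assumes "CARD('v) \<ge> 2"
    and "\<forall>r\<ge>0. a r \<ge> 0"
    and "\<exists>L. L-lipschitz_on {0..} a"
    and "mono_on {0..} a"
    and "\<forall>r>0. a r > 0"
    and "T \<ge> 0"
    and "caratheodory_solution (topological_field a) T x"
  shows "continuous_on {0..T} (\<lambda>t. W_fun a (x t)) \<and>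
         antimono_on {0..T} (\<lambda>t. W_fun a (x t))"
proof -
  note card = assms(1) and mono = assms(4)
  have nonneg: "\<And>r. 0 \<le> r \<Longrightarrow> 0 \<le> a r" using assms(2) by blast
  have cont: "continuous_on {0..} a" using assms(3) lipschitz_on_continuous_on by blast
  have ac: "absolutely_continuous_curve 0 T x"
    using assms(7) by (simp add: caratheodory_solution_def)
  obtain E where E: "negligible E" and ode: "\<And>t. t \<in> {0..T} - E \<Longrightarrow>
      (x has_vector_derivative topological_field a (x t)) (at t within {0..T})"
    using assms(7) unfolding caratheodory_solution_def negligible_iff_null_sets
    by (auto elim: AE_E3)
  have "bounded (x ` {0..T})"
    by (intro compact_imp_bounded compact_continuous_image compact_Icc
        absolutely_continuous_curve_imp_continuous_on ac)
  then obtain B where "0 < B" and B: "\<And>t. t \<in> {0..T} \<Longrightarrow> norm (x t) \<le> B"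
    by (auto simp: bounded_pos)
  define M where "M = real CARD('v) * (a (2 * B) * (2 * B))"
  have lip_x: "M-lipschitz_on {0..T} x"
  proof (rule lipschitz_on_if_ae_bounded_derivative[OF ac E])
    show "0 \<le> M" using nonneg[of "2 * B"] \<open>0 < B\<close> by (simp add: M_def)
    show "\<exists>D. norm D \<le> M \<and> (x has_vector_derivative D) (at t within {0..T})"
      if "t \<in> {0..T} - E" for t
      using ode[OF that] norm_topological_field_le[OF mono nonneg B] that unfolding M_def by blast
  qed
  obtain C where "C-lipschitz_on (cball 0 B) (W_fun a :: (real ^ 'n) ^ 'v::{finite,linorder} \<Rightarrow> real)"
    using W_fun_lipschitz[where a = a and B = B, OF card nonneg cont mono] \<open>0 < B\<close> by fastforce
  then have "C-lipschitz_on (x ` {0..T}) (W_fun a)"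
    by (rule lipschitz_on_subset) (use B in auto)
  then have lip: "(C * M)-lipschitz_on {0..T} (\<lambda>t. W_fun a (x t))"
    by (rule lipschitz_on_compose2[OF lip_x])
  have "antimono_on {0..T} (\<lambda>t. W_fun a (x t))"
  proof (rule antimono_on_if_right_dini_nonpos[OF lip E])
    fix t \<epsilon> :: real assume t: "t \<in> {0..<T} - E" and "0 < \<epsilon>"
    then have "\<forall>\<^sub>F s in at t within {0..T} \<inter> {t<..}. W_fun a (x s) - W_fun a (x t) \<le> \<epsilon> * (s - t)"
      by (intro W_fun_right_dini card nonneg cont mono ode) auto
    moreover have "at t within {0..T} \<inter> {t<..} = at_right t"
      by (rule at_within_nhd[of _ "{..<T}"]) (use t in auto)
    ultimately show "\<forall>\<^sub>F s in at_right t. W_fun a (x s) - W_fun a (x t) \<le> \<epsilon> * (s - t)"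
      by simp
  qed
  with lipschitz_on_continuous_on[OF lip] show ?thesis ..
qed

end
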